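(* Let $|\psi\rangle$ and $|\phi\rangle$ be pure three-particle states. (i) If $|\psi\rangle$ admits a decomposition with partition rank vector $\mathbf{r}$ and $|\phi\rangle$ can be reached from $|\psi\rangle$ via SLOCC, then $|\phi\rangle$ also admits a decomposition with partition rank vector $\mathbf{r}$. (ii) Specifically, if $|\phi\rangle$ has a tight partition rank vector $\mathbf{r}'$ and $|\psi\rangle$ admits a decomposition with a partition rank vector $\mathbf{r}<\mathbf{r}'$, then $|\phi\rangle$ cannot be reached from $|\psi\rangle$ via SLOCC.
   Context: The particles are $A,B,C$ with finite-dimensional complex Hilbert spaces. The bipartitions are $\mathcal{P}=\{A|BC,\;B|AC,\;C|AB\}$. A vector is separable with respect to a bipartition $X|YZ$ if it is of the form $|\alpha\rangle_X\otimes|\beta\rangle_{YZ}$ (the zero vector is allowed). A vector $|\psi\rangle$ admits a decomposition with partition rank vector (PRV) $\mathbf{r}=(\mathfrak{r}_{A|BC},\mathfrak{r}_{B|AC},\mathfrak{r}_{C|AB})$, with nonnegative integer entries, if $$|\psi\rangle=\sum_{P\in\mathcal{P}}\sum_{\ell=1}^{\mathfrak{r}_P}|\mu_\ell^P\rangle,$$ where each (not necessarily normalized) $|\mu^P_\ell\rangle$ is separable with respect to $P$. Equivalently, $|\psi\rangle=\sum_{P}|\gamma_P\rangle$, where $|\gamma_P\rangle$ has Schmidt rank at most $\mathfrak{r}_P$ with respect to $P$. A PRV $\mathbf{r}$ admitted by $|\psi\rangle$ is called tight (for $|\psi\rangle$) if $|\psi\rangle$ admits no decomposition with a PRV in which one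 entry is smaller than in $\mathbf{r}$ and the other entries are the same. For two PRVs, $\mathbf{r}<\mathbf{r}'$ means that $\mathbf{r}'-\mathbf{r}$ has only nonnegative entries and $\mathbf{r}\ne\mathbf{r}'$. $|\phi\rangle$ can be reached from $|\psi\rangle$ via SLOCC if there are matrices (linear maps) $A,B,C$ acting on the three local Hilbert spaces, not necessarily invertible, such that $|\phi\rangle=(A\otimes B\otimes C)|\psi\rangle$. *)

theory Defs
  imports "HOL-Analysis.Analysis"
begin

text \<open>
  The local spaces of the particles are modelled as \<open>complex ^ 'a\<close>, \<open>complex ^ 'b\<close>, \<open>complex ^ 'c\<close>,
  i.e. an orthonormal basis is chosen for each of them; their tensor product is then
  \<open>complex ^ ('a \<times> 'b \<times> 'c)\<close>.
\<close>

type_synonym ('a, 'b, 'c) tripartite = "complex ^ ('a \<times> 'b \<times> 'c)"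

text \<open>State vectors need not be normalized: every nonzero vector represents a pure state.\<close>

definition pure_state :: "('a::finite, 'b::finite, 'c::finite) tripartite \<Rightarrow> bool" where
  "pure_state \<psi> \<longleftrightarrow> \<psi> \<noteq> 0"

datatype bipartition = A_BC | B_AC | C_AB

lemma UNIV_bipartition: "UNIV = {A_BC, B_AC, C_AB}"
  by (auto intro: bipartition.exhaust)

instance bipartition :: finite
  by standard (simp add: UNIV_bipartition)

definition tensor_A_BC ::
  "complex ^ 'a \<Rightarrow> complex ^ ('b \<times> 'c) \<Rightarrow> ('a::finite, 'b::finite, 'c::finite) tripartite" where
  "tensor_A_BC \<alpha> \<beta> = (\<chi> p. case p of (i, j, k) \<Rightarrow> \<alpha> $ i * \<beta> $ (j, k))"

definition tensor_B_AC ::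
  "complex ^ 'b \<Rightarrow> complex ^ ('a \<times> 'c) \<Rightarrow> ('a::finite, 'b::finite, 'c::finite) tripartite" where
  "tensor_B_AC \<alpha> \<beta> = (\<chi> p. case p of (i, j, k) \<Rightarrow> \<alpha> $ j * \<beta> $ (i, k))"

definition tensor_C_AB ::
  "complex ^ 'c \<Rightarrow> complex ^ ('a \<times> 'b) \<Rightarrow> ('a::finite, 'b::finite, 'c::finite) tripartite" where
  "tensor_C_AB \<alpha> \<beta> = (\<chi> p. case p of (i, j, k) \<Rightarrow> \<alpha> $ k * \<beta> $ (i, j))"

fun separable_wrt ::
  "bipartition \<Rightarrow> ('a::finite, 'b::finite, 'c::finite) tripartite \<Rightarrow> bool" where
  "separable_wrt A_BC \<psi> \<longleftrightarrow> (\<exists>\<alpha> \<beta>. \<psi> = tensor_A_BC \<alpha> \<beta>)"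
| "separable_wrt B_AC \<psi> \<longleftrightarrow> (\<exists>\<alpha> \<beta>. \<psi> = tensor_B_AC \<alpha> \<beta>)"
| "separable_wrt C_AB \<psi> \<longleftrightarrow> (\<exists>\<alpha> \<beta>. \<psi> = tensor_C_AB \<alpha> \<beta>)"

text \<open>
  The order on partition rank vectors is the library's pointwise order on functions:
  \<open>r < r'\<close> means \<open>r P \<le> r' P\<close> for all \<open>P\<close> and \<open>r \<noteq> r'\<close>.
\<close>

type_synonym prv = "bipartition \<Rightarrow> nat"

definition admits_prv ::
  "('a::finite, 'b::finite, 'c::finite) tripartite \<Rightarrow> prv \<Rightarrow> bool" where
  "admits_prv \<psi> r \<longleftrightarrow>
     (\<exists>\<mu> :: bipartition \<Rightarrow> nat \<Rightarrow> ('a, 'b, 'c) tripartite.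
        (\<forall>P. \<forall>l<r P. separable_wrt P (\<mu> P l)) \<and> \<psi> = (\<Sum>P\<in>UNIV. \<Sum>l<r P. \<mu> P l))"

definition tight_prv ::
  "('a::finite, 'b::finite, 'c::finite) tripartite \<Rightarrow> prv \<Rightarrow> bool" where
  "tight_prv \<psi> r \<longleftrightarrow> admits_prv \<psi> r \<and> (\<forall>P. \<forall>m<r P. \<not> admits_prv \<psi> (r(P := m)))"

definition tensor_op ::
  "complex ^ 'a ^ 'a \<Rightarrow> complex ^ 'b ^ 'b \<Rightarrow> complex ^ 'c ^ 'c \<Rightarrow>
     complex ^ ('a::finite \<times> 'b::finite \<times> 'c::finite) ^ ('a \<times> 'b \<times> 'c)" where
  "tensor_op A B C =
     (\<chi> p q. case (p, q) of ((i, j, k), (i', j', k')) \<Rightarrow> A $ i $ i' * B $ j $ j' * C $ k $ k')"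

definition slocc_reachable ::
  "('a::finite, 'b::finite, 'c::finite) tripartite \<Rightarrow> ('a, 'b, 'c) tripartite \<Rightarrow> bool" where
  "slocc_reachable \<psi> \<phi> \<longleftrightarrow> (\<exists>A B C. \<phi> = tensor_op A B C *v \<psi>)"

end

theory Submission
  imports Defs
begin

text \<open>A local operator preserves separability across each bipartition X|YZ: it sends a product
  vector to the product of the image of the X factor under the X matrix and the image of the YZ
  factor under the Kronecker product of the other two matrices. By linearity, applying it to every
  term of a decomposition of \<psi> yields a decomposition of \<phi> with equally many terms for
  each bipartition (\<open>admits_prv_slocc\<close>), which is (i). For (ii), reachability would
  give \<phi> a decomposition with PRV \<open>r\<close> strictly below the tight one. Padding with
  zero vectors (\<open>admits_prv_mono\<close>) enlarges \<open>r\<close> until it differs from the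
  tight PRV in a single entry, a contradiction (\<open>tight_prv_not_admits_less\<close>).\<close>

definition kronecker ::
  "complex ^ 'm ^ 'm \<Rightarrow> complex ^ 'n ^ 'n \<Rightarrow> complex ^ ('m::finite \<times> 'n::finite) ^ ('m \<times> 'n)" where
  "kronecker A B = (\<chi> p q. A $ fst p $ fst q * B $ snd p $ snd q)"

lemma kronecker_mult_vec_nth:
  "(kronecker A B *v x) $ (i, j) = (\<Sum>i'\<in>UNIV. \<Sum>j'\<in>UNIV. A $ i $ i' * B $ j $ j' * x $ (i', j'))"
  by (simp add: kronecker_def matrix_vector_mult_def sum.cartesian_product split_def)

text \<open>Iterated sums let each local index be summed separately, so that sums over product
  vectors can factor.\<close>

lemma tensor_op_mult_vec_nth:
  "(tensor_op A B C *v x) $ (i, j, k) =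
     (\<Sum>i'\<in>UNIV. \<Sum>j'\<in>UNIV. \<Sum>k'\<in>UNIV. A $ i $ i' * B $ j $ j' * C $ k $ k' * x $ (i', j', k'))"
  by (simp add: tensor_op_def matrix_vector_mult_def sum.cartesian_product split_def)

lemma matrix_vector_mult_nth: "(A *v x) $ i = (\<Sum>j\<in>UNIV. A $ i $ j * x $ j)"
  by (simp add: matrix_vector_mult_def)

lemma tensor_op_tensor_A_BC:
  "tensor_op A B C *v tensor_A_BC \<alpha> \<beta> = tensor_A_BC (A *v \<alpha>) (kronecker B C *v \<beta>)"
proof -
  have "(tensor_op A B C *v tensor_A_BC \<alpha> \<beta>) $ (i, j, k) =
      tensor_A_BC (A *v \<alpha>) (kronecker B C *v \<beta>) $ (i, j, k)" for i j k
    by (simp add: tensor_op_mult_vec_nth tensor_A_BC_def kronecker_mult_vec_nth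
        matrix_vector_mult_nth [of A \<alpha>] sum_product)
       (simp add: sum_distrib_left mult_ac)
  then show ?thesis
    by (auto simp: vec_eq_iff)
qed

lemma tensor_op_tensor_B_AC:
  "tensor_op A B C *v tensor_B_AC \<alpha> \<beta> = tensor_B_AC (B *v \<alpha>) (kronecker A C *v \<beta>)"
proof -
  have "(tensor_op A B C *v tensor_B_AC \<alpha> \<beta>) $ (i, j, k) =
      tensor_B_AC (B *v \<alpha>) (kronecker A C *v \<beta>) $ (i, j, k)" for i j k
  proof -
    \<comment> \<open>\<open>sum_product\<close> puts the index of the single particle outermost, so
      the sum over \<open>j'\<close> is moved to the front to match.\<close>
    have "(tensor_op A B C *v tensor_B_AC \<alpha> \<beta>) $ (i, j, k) =
        (\<Sum>j'\<in>UNIV. \<Sum>i'\<in>UNIV. \<Sum>k'\<in>UNIV.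
          A $ i $ i' * B $ j $ j' * C $ k $ k' * (\<alpha> $ j' * \<beta> $ (i', k')))"
      unfolding tensor_op_mult_vec_nth tensor_B_AC_def by (subst sum.swap) simp
    then show ?thesis
      by (simp add: tensor_B_AC_def kronecker_mult_vec_nth matrix_vector_mult_nth [of B \<alpha>] sum_product)
         (simp add: sum_distrib_left mult_ac)
  qed
  then show ?thesis
    by (auto simp: vec_eq_iff)
qed

lemma tensor_op_tensor_C_AB:
  "tensor_op A B C *v tensor_C_AB \<alpha> \<beta> = tensor_C_AB (C *v \<alpha>) (kronecker A B *v \<beta>)"
proof -
  have "(tensor_op A B C *v tensor_C_AB \<alpha> \<beta>) $ (i, j, k) =
      tensor_C_AB (C *v \<alpha>) (kronecker A B *v \<beta>) $ (i, j, k)" for i j k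
  proof -
    \<comment> \<open>Here the index \<open>k'\<close> of the single particle starts innermost, so
      two exchanges are needed: past \<open>j'\<close> under the sum over \<open>i'\<close>, then
      past \<open>i'\<close>.\<close>
    have "(tensor_op A B C *v tensor_C_AB \<alpha> \<beta>) $ (i, j, k) =
        (\<Sum>i'\<in>UNIV. \<Sum>k'\<in>UNIV. \<Sum>j'\<in>UNIV.
          A $ i $ i' * B $ j $ j' * C $ k $ k' * (\<alpha> $ k' * \<beta> $ (i', j')))"
      unfolding tensor_op_mult_vec_nth tensor_C_AB_def
      by (rule sum.cong [OF refl], subst sum.swap) simp
    also have "\<dots> = (\<Sum>k'\<in>UNIV. \<Sum>i'\<in>UNIV. \<Sum>j'\<in>UNIV.
          A $ i $ i' * B $ j $ j' * C $ k $ k' * (\<alpha> $ k' * \<beta> $ (i', j')))"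
      by (rule sum.swap)
    finally show ?thesis
      by (simp add: tensor_C_AB_def kronecker_mult_vec_nth matrix_vector_mult_nth [of C \<alpha>] sum_product)
         (simp add: sum_distrib_left mult_ac)
  qed
  then show ?thesis
    by (auto simp: vec_eq_iff)
qed

lemma separable_wrt_tensor_op:
  assumes "separable_wrt P \<psi>"
  shows "separable_wrt P (tensor_op A B C *v \<psi>)"
  using assms
  by (cases P)
     (auto simp: tensor_op_tensor_A_BC tensor_op_tensor_B_AC tensor_op_tensor_C_AB, blast+)

text \<open>Makes the zero vector available as a padding term for every bipartition.\<close>

lemma separable_wrt_zero: "separable_wrt P 0"
proof (cases P)
  case A_BC
  have "0 = tensor_A_BC 0 0" by (simp add: tensor_A_BC_def vec_eq_iff)
  with A_BC show ?thesis by auto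
next
  case B_AC
  have "0 = tensor_B_AC 0 0" by (simp add: tensor_B_AC_def vec_eq_iff)
  with B_AC show ?thesis by auto
next
  case C_AB
  have "0 = tensor_C_AB 0 0" by (simp add: tensor_C_AB_def vec_eq_iff)
  with C_AB show ?thesis by auto
qed

lemma matrix_vector_mult_sum_right:
  fixes M :: "'a::comm_ring_1 ^ 'n ^ 'm"
  shows "M *v (\<Sum>i\<in>I. f i) = (\<Sum>i\<in>I. M *v f i)"
  by (induction I rule: infinite_finite_induct) (simp_all add: matrix_vector_right_distrib)

lemma admits_prv_slocc:
  assumes "admits_prv \<psi> r" and "slocc_reachable \<psi> \<phi>"
  shows "admits_prv \<phi> r"
proof -
  obtain \<mu> where \<mu>: "\<And>P l. l < r P \<Longrightarrow> separable_wrt P (\<mu> P l)"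
    and \<psi>: "\<psi> = (\<Sum>P\<in>UNIV. \<Sum>l<r P. \<mu> P l)"
    using assms(1) unfolding admits_prv_def by blast
  obtain A B C where "\<phi> = tensor_op A B C *v \<psi>"
    using assms(2) unfolding slocc_reachable_def by blast
  then have "\<phi> = (\<Sum>P\<in>UNIV. \<Sum>l<r P. tensor_op A B C *v \<mu> P l)"
    by (simp add: \<psi> matrix_vector_mult_sum_right)
  moreover have "\<forall>P. \<forall>l<r P. separable_wrt P (tensor_op A B C *v \<mu> P l)"
    using \<mu> separable_wrt_tensor_op by blast
  ultimately show ?thesis
    unfolding admits_prv_def by (intro exI [of _ "\<lambda>P l. tensor_op A B C *v \<mu> P l"]) simp
qed

lemma admits_prv_mono:
  assumes "admits_prv \<psi> r" and "r \<le> s"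
  shows "admits_prv \<psi> s"
proof -
  obtain \<mu> where \<mu>: "\<And>P l. l < r P \<Longrightarrow> separable_wrt P (\<mu> P l)"
    and \<psi>: "\<psi> = (\<Sum>P\<in>UNIV. \<Sum>l<r P. \<mu> P l)"
    using assms(1) unfolding admits_prv_def by blast
  \<comment> \<open>The missing terms are filled with zeros, which are separable and leave the sum
    unchanged.\<close>
  define \<nu> where "\<nu> P l = (if l < r P then \<mu> P l else 0)" for P l
  have "(\<Sum>l<r P. \<mu> P l) = (\<Sum>l<s P. \<nu> P l)" for P
    using le_funD [OF assms(2), of P] by (intro sum.mono_neutral_cong_left) (auto simp: \<nu>_def)
  then have "\<psi> = (\<Sum>P\<in>UNIV. \<Sum>l<s P. \<nu> P l)"
    by (simp add: \<psi>)
  moreover have "\<forall>P. \<forall>l<s P. separable_wrt P (\<nu> P l)"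
    by (simp add: \<nu>_def \<mu> separable_wrt_zero)
  ultimately show ?thesis
    unfolding admits_prv_def by blast
qed

lemma tight_prv_not_admits_less:
  assumes "tight_prv \<phi> s" and "r < s"
  shows "\<not> admits_prv \<phi> r"
proof
  assume "admits_prv \<phi> r"
  \<comment> \<open>Strictness of the pointwise order yields an entry where \<open>r\<close> is
    strictly smaller.\<close>
  obtain P where P: "r P < s P"
    using assms(2) by (auto simp: less_fun_def le_fun_def not_le)
  \<comment> \<open>Tightness only excludes lowering one entry of \<open>s\<close>, whereas
    \<open>r\<close> may be lower in several; hence all entries of \<open>r\<close> except the one
    at \<open>P\<close> are raised to those of \<open>s\<close>.\<close>
  have "r \<le> s(P := r P)"
    using assms(2) by (auto simp: less_fun_def le_fun_def)
  with \<open>admits_prv \<phi> r\<close> have "admits_prv \<phi> (s(P := r P))"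
    by (rule admits_prv_mono)
  with assms(1) P show False
    unfolding tight_prv_def by blast
qed

theorem mainTheorem3:
  fixes \<psi> \<phi> :: "('a::finite, 'b::finite, 'c::finite) tripartite"
  assumes "pure_state \<psi>" and "pure_state \<phi>"
  shows "(\<forall>r. admits_prv \<psi> r \<and> slocc_reachable \<psi> \<phi> \<longrightarrow> admits_prv \<phi> r) \<and>
         (\<forall>r r'. tight_prv \<phi> r' \<and> admits_prv \<psi> r \<and> r < r' \<longrightarrow> \<not> slocc_reachable \<psi> \<phi>)"
  using admits_prv_slocc tight_prv_not_admits_less by blast

end
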